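(* For each integer $n\ge 3$ let $S_n=\{1,10,20,30\}\cup\{3,3^2,3^3,\dots,3^n\}$, and let $S=\bigcup_{n=3}^{\infty}S_n$. Then there is an arithmetic map $\gamma:S\to\mathbb{Z}[\sqrt{-1}]$ which moves all $r\in S\setminus\{1\}$, i.e. $\gamma(r)\ne r$ for every $r\in S\setminus\{1\}$. Moreover, for each integer $n\ge 3$ and each $r\in S_n\setminus\{1\}$: (i) $S_n$ is an arithmetic neighbourhood of $r$ inside $\mathbb{R}$, and so too inside $\mathbb{Q}$ and inside $\mathbb{Z}$; (ii) $S_n$ is not an arithmetic neighbourhood of $r$ inside $\mathbb{Z}[\sqrt{-1}]$.
   Context: Let $K$ be a ring (with $1$) and $A\subseteq K$. A map $f:A\to K$ is called arithmetic if: (1) if $1\in A$ then $f(1)=1$; (2) if $a,b\in A$ and $a+b\in A$ then $f(a+b)=f(a)+f(b)$; (3) if $a,b\in A$ and $a\cdot b\in A$ then $f(a\cdot b)=f(a)\cdot f(b)$. (In (2) and (3), $a=b$ is allowed.) A finite set $A\subseteq K$ with $r\in A$ is an arithmetic neighbourhood of $r$ inside $K$ if every arithmetic map $f:A\to K$ satisfies $f(r)=r$. *)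

theory Defs
  imports Complex_Main "HOL-Library.FuncSet"
begin

text \<open>
  Rings are represented as unital subrings \<open>K\<close> of a type of class \<open>ring_1\<close> (take \<open>K = UNIV\<close> for the
  whole type), so that \<open>\<int>\<close>, \<open>\<rat>\<close>, \<open>\<real>\<close> and the Gaussian integers can all be taken inside \<open>complex\<close>
  and share their elements. A map \<open>A \<rightarrow> K\<close> is a HOL function of which only the values on \<open>A\<close> matter.
\<close>

definition unital_subring :: "'a::ring_1 set \<Rightarrow> bool" where
  "unital_subring K \<longleftrightarrow>
     0 \<in> K \<and> 1 \<in> K \<and> (\<forall>x\<in>K. - x \<in> K) \<and>
     (\<forall>x\<in>K. \<forall>y\<in>K. x + y \<in> K \<and> x * y \<in> K)"

definition arithmetic_map :: "'a::ring_1 set \<Rightarrow> 'a set \<Rightarrow> ('a \<Rightarrow> 'a) \<Rightarrow> bool" where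
  "arithmetic_map K A f \<longleftrightarrow>
     A \<subseteq> K \<and> f \<in> A \<rightarrow> K \<and>
     (1 \<in> A \<longrightarrow> f 1 = 1) \<and>
     (\<forall>a\<in>A. \<forall>b\<in>A. a + b \<in> A \<longrightarrow> f (a + b) = f a + f b) \<and>
     (\<forall>a\<in>A. \<forall>b\<in>A. a * b \<in> A \<longrightarrow> f (a * b) = f a * f b)"

definition arithmetic_neighbourhood :: "'a::ring_1 set \<Rightarrow> 'a set \<Rightarrow> 'a \<Rightarrow> bool" where
  "arithmetic_neighbourhood K A r \<longleftrightarrow>
     finite A \<and> A \<subseteq> K \<and> r \<in> A \<and> (\<forall>f. arithmetic_map K A f \<longrightarrow> f r = r)"

definition gaussian_integers :: "complex set" where
  "gaussian_integers = {of_int a + of_int b * \<i> | a b. True}"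

definition S_n :: "nat \<Rightarrow> complex set" where
  "S_n n = {1, 10, 20, 30} \<union> {3 ^ k | k. 1 \<le> k \<and> k \<le> n}"

definition S_all :: "complex set" where
  "S_all = (\<Union>n\<in>{3..}. S_n n)"

lemma unital_subring_Ints: "unital_subring (\<int> :: 'a::ring_1 set)"
  by (simp add: unital_subring_def)

lemma unital_subring_Rats: "unital_subring (\<rat> :: 'a::field_char_0 set)"
  by (simp add: unital_subring_def)

lemma unital_subring_Reals: "unital_subring (\<real> :: 'a::real_algebra_1 set)"
  by (simp add: unital_subring_def)

lemma gaussian_integers_iff: "z \<in> gaussian_integers \<longleftrightarrow> Re z \<in> \<int> \<and> Im z \<in> \<int>"
  unfolding gaussian_integers_def by (auto simp: complex_eq_iff elim!: Ints_cases)

lemma unital_subring_gaussian_integers: "unital_subring gaussian_integers"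
  by (simp add: unital_subring_def gaussian_integers_iff)

end

theory Submission imports Defs begin

text \<open>
  Let \<open>f\<close> be an arithmetic map on \<open>S_n n\<close> and put \<open>s = f 3\<close>. Since \<open>10 = 1 + 3 * 3\<close>, we have
  \<open>f 10 = 1 + s\<^sup>2\<close>, and \<open>30\<close> can be reached from \<open>10\<close> in two ways, as \<open>3 * 10\<close> and as
  \<open>10 + 20\<close> with \<open>20 = 10 + 10\<close>. Comparing them gives \<open>(s - 3) * (1 + s\<^sup>2) = 0\<close>. A real \<open>s\<close> must therefore be \<open>3\<close>,
  and then \<open>f\<close> fixes the powers of \<open>3\<close> and the three multiples of \<open>10\<close>. This is
  \<open>arithmetic_map_S_n_fixes\<close>.

  In the Gaussian integers the other factor vanishes for \<open>s = \<i>\<close>, which forces \<open>3 ^ k \<mapsto> \<i> ^ k\<close> and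
  \<open>10, 20, 30 \<mapsto> 0\<close>. Since \<open>3\<close> generates the units modulo \<open>10\<close>, this assignment is the restriction
  of a Dirichlet character modulo \<open>10\<close>, so it is multiplicative on all natural numbers. It also
  respects every sum inside \<open>S_all\<close>: by parity one of \<open>a\<close>, \<open>b\<close>, \<open>a + b\<close> is even, and the even members
  of \<open>S_all\<close> are multiples of \<open>10\<close>, so additivity reduces to the facts that the character is periodic
  modulo \<open>10\<close> and odd. Finally, the character has absolute value at most \<open>1\<close>, so it can fix no number
  greater than \<open>1\<close>. Restricting it to \<open>S_n n\<close> refutes the neighbourhood property there.
\<close>

section \<open>Rigidity over the reals\<close>

lemma arithmetic_map_one: "arithmetic_map K A f \<Longrightarrow> 1 \<in> A \<Longrightarrow> f 1 = 1"
  by (simp add: arithmetic_map_def)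

lemma arithmetic_map_add:
  "arithmetic_map K A f \<Longrightarrow> a \<in> A \<Longrightarrow> b \<in> A \<Longrightarrow> a + b \<in> A \<Longrightarrow> f (a + b) = f a + f b"
  by (simp add: arithmetic_map_def)

lemma arithmetic_map_mult:
  "arithmetic_map K A f \<Longrightarrow> a \<in> A \<Longrightarrow> b \<in> A \<Longrightarrow> a * b \<in> A \<Longrightarrow> f (a * b) = f a * f b"
  by (simp add: arithmetic_map_def)

lemma arithmetic_map_subset:
  "arithmetic_map K A f \<Longrightarrow> B \<subseteq> A \<Longrightarrow> arithmetic_map K B f"
  unfolding arithmetic_map_def by blast

lemma finite_S_n: "finite (S_n n)"
proof -
  have "{3 ^ k | k. 1 \<le> k \<and> k \<le> n} = (\<lambda>k. 3 ^ k :: complex) ` {1..n}"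
    by auto
  then show ?thesis
    by (simp add: S_n_def)
qed

lemma power_3_in_S_n: "1 \<le> k \<Longrightarrow> k \<le> n \<Longrightarrow> 3 ^ k \<in> S_n n"
  by (auto simp: S_n_def)

lemma S_n_subset_Ints: "S_n n \<subseteq> \<int>"
  by (auto simp: S_n_def)

lemma one_plus_square_nonzero:
  fixes z :: complex
  assumes "z \<in> \<real>"
  shows "1 + z * z \<noteq> 0"
proof -
  from assms obtain x where z: "z = of_real x"
    by (auto elim: Reals_cases)
  have "1 + x * x \<noteq> 0"
    using zero_le_square[of x] by linarith
  then have "complex_of_real (1 + x * x) \<noteq> 0"
    by (simp only: of_real_eq_0_iff not_False_eq_True)
  then show ?thesis
    by (simp add: z)
qed

text \<open>
  Only the reality of the values enters, through \<open>one_plus_square_nonzero\<close>, so one argument serves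
  \<open>\<real>\<close>, \<open>\<rat>\<close> and \<open>\<int>\<close> alike. The bound \<open>2 \<le> n\<close> puts \<open>9\<close>, the link between \<open>3\<close> and \<open>10\<close>, into the set.
\<close>

lemma arithmetic_map_S_n_fixes:
  assumes n: "2 \<le> n" and K: "K \<subseteq> \<real>" and f: "arithmetic_map K (S_n n) f" and r: "r \<in> S_n n"
  shows "f r = r"
proof -
  have mem: "1 \<in> S_n n" "10 \<in> S_n n" "20 \<in> S_n n" "30 \<in> S_n n"
    by (simp_all add: S_n_def)
  have mem3: "3 \<in> S_n n" "9 \<in> S_n n"
    using n power_3_in_S_n[of 1 n] power_3_in_S_n[of 2 n] by simp_all
  have f1: "f 1 = 1"
    using arithmetic_map_one[OF f] mem by simp
  have f9: "f 9 = f 3 * f 3"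
    using arithmetic_map_mult[OF f, of 3 3] mem3 by simp
  have f10: "f 10 = 1 + f 3 * f 3"
    using arithmetic_map_add[OF f, of 1 9] mem mem3 f1 f9 by simp
  have f20: "f 20 = f 10 + f 10"
    using arithmetic_map_add[OF f, of 10 10] mem by simp
  have f30: "f 30 = f 10 + f 20"
    using arithmetic_map_add[OF f, of 10 20] mem by simp
  have f30': "f 30 = f 3 * f 10"
    using arithmetic_map_mult[OF f, of 3 10] mem mem3 by simp
  have "f 3 \<in> \<real>"
    using f mem3 K unfolding arithmetic_map_def by blast
  then have "f 10 \<noteq> 0"
    using one_plus_square_nonzero f10 by simp
  moreover have "f 3 * f 10 = 3 * f 10"
    using f30 f30' f20 by simp
  ultimately have f3: "f 3 = 3"
    by simp
  have pow: "f (3 ^ k) = 3 ^ k" if "1 \<le> k" "k \<le> n" for k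
    using that
  proof (induction k rule: dec_induct)
    case base
    show ?case using f3 by simp
  next
    case (step m)
    have "3 ^ m \<in> S_n n" "3 * 3 ^ m \<in> S_n n"
      using step power_3_in_S_n[of m n] power_3_in_S_n[of "Suc m" n] by simp_all
    then have "f (3 * 3 ^ m) = f 3 * f (3 ^ m)"
      using arithmetic_map_mult[OF f] mem3 by blast
    then show ?case
      using step f3 by simp
  qed
  show ?thesis
    using r pow f1 f10 f20 f30 f3 by (auto simp: S_n_def)
qed

lemma arithmetic_neighbourhood_S_n:
  assumes "2 \<le> n" "K \<subseteq> \<real>" "\<int> \<subseteq> K" "r \<in> S_n n"
  shows "arithmetic_neighbourhood K (S_n n) r"
  unfolding arithmetic_neighbourhood_def
proof (intro conjI allI impI)
  show "finite (S_n n)"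
    by (rule finite_S_n)
  show "S_n n \<subseteq> K"
    using S_n_subset_Ints assms(3) by (rule subset_trans)
  show "r \<in> S_n n"
    by (rule assms(4))
  show "f r = r" if "arithmetic_map K (S_n n) f" for f
    by (rule arithmetic_map_S_n_fixes[OF assms(1,2) that assms(4)])
qed

section \<open>A character modulo 10 on the Gaussian side\<close>

text \<open>The Dirichlet character modulo \<open>10\<close> that sends the generator \<open>3\<close> of the units to \<open>\<i>\<close>.\<close>

definition chi10 :: "nat \<Rightarrow> complex" where
  "chi10 m =
     (if m mod 10 = 1 then 1 else if m mod 10 = 3 then \<i>
      else if m mod 10 = 9 then - 1 else if m mod 10 = 7 then - \<i> else 0)"

lemma chi10_1: "chi10 1 = 1"
  by (simp add: chi10_def)

lemma chi10_multiple: "10 dvd m \<Longrightarrow> chi10 m = 0"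
  by (simp add: chi10_def)

lemma chi10_gaussian: "chi10 m \<in> gaussian_integers"
  by (simp add: chi10_def gaussian_integers_iff)

lemma norm_chi10_le: "norm (chi10 m) \<le> 1"
  by (simp add: chi10_def)

lemma chi10_add_multiple: "10 dvd b \<Longrightarrow> chi10 (a + b) = chi10 a"
  by (auto simp: chi10_def elim!: dvdE)

lemma chi10_mod: "chi10 (m mod 10) = chi10 m"
  by (simp add: chi10_def)

lemma mod_10_range:
  fixes m :: nat
  shows "m mod 10 \<in> {0, 1, 2, 3, 4, 5, 6, 7, 8, 9}"
proof -
  have "m mod 10 = 0 \<or> m mod 10 = 1 \<or> m mod 10 = 2 \<or> m mod 10 = 3 \<or> m mod 10 = 4 \<or>
      m mod 10 = 5 \<or> m mod 10 = 6 \<or> m mod 10 = 7 \<or> m mod 10 = 8 \<or> m mod 10 = 9"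
    by presburger
  then show ?thesis
    by simp
qed

lemma chi10_odd_function:
  assumes "10 dvd a + b"
  shows "chi10 a + chi10 b = 0"
proof -
  define x y where "x = a mod 10" and "y = b mod 10"
  have "x \<in> {0, 1, 2, 3, 4, 5, 6, 7, 8, 9}" "y \<in> {0, 1, 2, 3, 4, 5, 6, 7, 8, 9}"
    unfolding x_def y_def by (rule mod_10_range)+
  moreover have "(x + y) mod 10 = 0"
    using assms by (simp add: x_def y_def mod_simps)
  ultimately have "chi10 x + chi10 y = 0"
    by (elim insertE emptyE) (simp_all add: chi10_def)
  then show ?thesis
    by (simp add: x_def y_def chi10_mod)
qed

lemma chi10_mult: "chi10 (a * b) = chi10 a * chi10 b"
proof -
  define x y where "x = a mod 10" and "y = b mod 10"
  have "x \<in> {0, 1, 2, 3, 4, 5, 6, 7, 8, 9}" "y \<in> {0, 1, 2, 3, 4, 5, 6, 7, 8, 9}"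
    unfolding x_def y_def by (rule mod_10_range)+
  then have "chi10 (x * y) = chi10 x * chi10 y"
    by (elim insertE emptyE) (simp_all add: chi10_def)
  moreover have "chi10 (x * y) = chi10 (a * b)"
    using chi10_mod[of "x * y"] chi10_mod[of "a * b"] by (simp add: x_def y_def mod_simps)
  ultimately show ?thesis
    by (simp add: x_def y_def chi10_mod)
qed

text \<open>
  The hypothesis is what parity gives for a sum inside \<open>S_all\<close>: it cannot have all of \<open>a\<close>, \<open>b\<close> and
  \<open>a + b\<close> odd.
\<close>

lemma chi10_add:
  assumes "10 dvd a \<or> 10 dvd b \<or> 10 dvd a + b"
  shows "chi10 (a + b) = chi10 a + chi10 b"
  using assms
proof (elim disjE)
  assume "10 dvd a"
  then show ?thesis
    using chi10_add_multiple[of a b] by (simp add: chi10_multiple add.commute)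
next
  assume "10 dvd b"
  then show ?thesis
    by (simp add: chi10_add_multiple chi10_multiple)
next
  assume "10 dvd a + b"
  then show ?thesis
    by (simp add: chi10_odd_function chi10_multiple)
qed

text \<open>
  The even members of \<open>S_all\<close> are \<open>10\<close>, \<open>20\<close>, \<open>30\<close> and the others are powers of \<open>3\<close>; this turns
  parity into the divisibility hypothesis of \<open>chi10_add\<close>. Positivity excludes \<open>0\<close>, which besides \<open>1\<close>
  is the only number that \<open>chi10\<close> fixes.
\<close>

lemma S_all_cases:
  assumes "z \<in> S_all"
  obtains m where "z = of_nat m" "m > 0" "even m \<Longrightarrow> 10 dvd m"
proof -
  from assms consider "z = 10" | "z = 20" | "z = 30" | k where "z = 3 ^ k"
    by (auto simp: S_all_def S_n_def) (metis power_0)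
  then show thesis
  proof cases
    case 1
    then show ?thesis using that[of 10] by simp
  next
    case 2
    then show ?thesis using that[of 20] by simp
  next
    case 3
    then show ?thesis using that[of 30] by simp
  next
    case (4 k)
    then show ?thesis using that[of "3 ^ k"] by simp
  qed
qed

lemma chi10_moves:
  assumes "m > 1"
  shows "chi10 m \<noteq> of_nat m"
proof
  assume "chi10 m = of_nat m"
  then have "real m \<le> 1"
    using norm_chi10_le[of m] by simp
  with assms show False
    by simp
qed

text \<open>The character transported along \<open>of_nat\<close>, of which \<open>\<lambda>z. nat \<lfloor>Re z\<rfloor>\<close> is a left inverse.\<close>

definition gamma_map :: "complex \<Rightarrow> complex" where
  "gamma_map z = chi10 (nat \<lfloor>Re z\<rfloor>)"

lemma gamma_map_of_nat: "gamma_map (of_nat m) = chi10 m"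
  by (simp add: gamma_map_def)

lemma arithmetic_map_gamma: "arithmetic_map gaussian_integers S_all gamma_map"
  unfolding arithmetic_map_def
proof (intro conjI ballI impI)
  show "S_all \<subseteq> gaussian_integers"
    by (auto simp: gaussian_integers_iff elim: S_all_cases)
  show "gamma_map \<in> S_all \<rightarrow> gaussian_integers"
    by (simp add: gamma_map_def chi10_gaussian)
  show "gamma_map 1 = 1"
    using gamma_map_of_nat[of 1] chi10_1 by simp
next
  fix a b
  assume "a \<in> S_all" "b \<in> S_all" and sum: "a + b \<in> S_all"
  then obtain k l where a: "a = of_nat k" "even k \<Longrightarrow> 10 dvd k"
    and b: "b = of_nat l" "even l \<Longrightarrow> 10 dvd l"
    by (metis S_all_cases)
  obtain m where m: "a + b = of_nat m" "even m \<Longrightarrow> 10 dvd m"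
    using sum by (blast elim: S_all_cases)
  have "of_nat m = (of_nat (k + l) :: complex)"
    using m a b by simp
  then have "m = k + l"
    by (rule of_nat_eq_iff[THEN iffD1])
  then have "10 dvd k \<or> 10 dvd l \<or> 10 dvd k + l"
    using a b m by auto
  then have "chi10 (k + l) = chi10 k + chi10 l"
    by (rule chi10_add)
  then show "gamma_map (a + b) = gamma_map a + gamma_map b"
    by (simp only: a b gamma_map_of_nat of_nat_add[symmetric])
next
  fix a b
  assume "a \<in> S_all" "b \<in> S_all"
  then obtain k l where "a = of_nat k" "b = of_nat l"
    by (metis S_all_cases)
  then show "gamma_map (a * b) = gamma_map a * gamma_map b"
    by (simp only: chi10_mult gamma_map_of_nat of_nat_mult[symmetric])
qed

lemma gamma_map_moves:
  assumes "r \<in> S_all - {1}"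
  shows "gamma_map r \<noteq> r"
proof -
  from assms obtain m where m: "r = of_nat m" "m > 0"
    by (blast elim: S_all_cases)
  with assms have "m \<noteq> 1"
    by auto
  with m have "m > 1"
    by simp
  then show ?thesis
    by (simp add: m gamma_map_of_nat chi10_moves)
qed

theorem theorem1:
  "(\<exists>\<gamma>. arithmetic_map gaussian_integers S_all \<gamma> \<and> (\<forall>r\<in>S_all - {1}. \<gamma> r \<noteq> r)) \<and>
   (\<forall>n\<ge>3. \<forall>r\<in>S_n n - {1}.
      (arithmetic_neighbourhood \<real> (S_n n) r \<and>
       arithmetic_neighbourhood \<rat> (S_n n) r \<and>
       arithmetic_neighbourhood \<int> (S_n n) r) \<and>
      \<not> arithmetic_neighbourhood gaussian_integers (S_n n) r)"
proof (intro conjI exI[of _ gamma_map] allI impI ballI)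
  show "arithmetic_map gaussian_integers S_all gamma_map"
    by (rule arithmetic_map_gamma)
  show "gamma_map r \<noteq> r" if "r \<in> S_all - {1}" for r
    using that by (rule gamma_map_moves)
next
  fix n :: nat and r
  assume n: "3 \<le> n" and r: "r \<in> S_n n - {1}"
  have Ints_Rats: "(\<int> :: complex set) \<subseteq> \<rat>"
    by (auto elim: Ints_cases)
  have Rats_Reals: "(\<rat> :: complex set) \<subseteq> \<real>"
    by (auto elim!: Rats_cases')
  show "arithmetic_neighbourhood \<real> (S_n n) r"
       "arithmetic_neighbourhood \<rat> (S_n n) r"
       "arithmetic_neighbourhood \<int> (S_n n) r"
    using n r Ints_Rats Rats_Reals by (auto intro!: arithmetic_neighbourhood_S_n)
  have sub: "S_n n \<subseteq> S_all"
    using n by (auto simp: S_all_def)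
  show "\<not> arithmetic_neighbourhood gaussian_integers (S_n n) r"
    using arithmetic_map_subset[OF arithmetic_map_gamma sub] gamma_map_moves[of r] r sub
    unfolding arithmetic_neighbourhood_def by blast
qed

end
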